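(* Let $G$ be a finite simple graph on $n$ vertices and $m$ edges, with maximum vertex degree $\Delta$ and minimum vertex degree $\delta$, and let $\overline{m}=|E(\overline{G})|$. Then: (i) $SO(G)+\overline{SO}(G)\leq \dfrac{n(n-1)\Delta}{\sqrt{2}}$, and equality holds if $G$ is a regular graph. (ii) $SO(\overline{G})+\overline{SO}(G)\leq \sqrt{2}\,\overline{m}\,(n-1+\Delta-\delta)$, and equality holds if $G$ is a regular graph.
   Context: All graphs are finite and simple, with nonempty vertex set. $d_G(u)$ denotes the degree of $u$ in $G$, and $\overline{G}$ is the complement of $G$; $\overline{m}=|E(\overline{G})|=\binom{n}{2}-m$. The Sombor index of a graph $H$ is $$SO(H)=\sum_{uv\in E(H)}\sqrt{d_H(u)^2+d_H(v)^2},$$ and the Sombor coindex of $G$ is $$\overline{SO}(G)=\sum_{uv\in E(\overline{G})}\sqrt{d_G(u)^2+d_G(v)^2},$$ where the latter sum is over unordered pairs of distinct non-adjacent vertices of $G$ and the degrees are taken in $G$ (so $\overline{SO}(G)$ is in general different from $SO(\overline{G})$). *)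

theory Defs
  imports Complex_Main
begin

text \<open>
  A graph is given by its vertex set \<open>V\<close> and its edge set \<open>E\<close>, edges being two-element sets
  of vertices.
\<close>

definition vertex_pairs :: "'a set \<Rightarrow> 'a set set" where
  "vertex_pairs V = {{u, v} | u v. u \<in> V \<and> v \<in> V \<and> u \<noteq> v}"

definition simple_graph :: "'a set \<Rightarrow> 'a set set \<Rightarrow> bool" where
  "simple_graph V E \<longleftrightarrow> finite V \<and> V \<noteq> {} \<and> E \<subseteq> vertex_pairs V"

definition complement_edges :: "'a set \<Rightarrow> 'a set set \<Rightarrow> 'a set set" where
  "complement_edges V E = vertex_pairs V - E"

definition degree :: "'a set set \<Rightarrow> 'a \<Rightarrow> nat" where
  "degree E u = card {e \<in> E. u \<in> e}"

definition max_degree :: "'a set \<Rightarrow> 'a set set \<Rightarrow> nat" where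
  "max_degree V E = Max (degree E ` V)"

definition min_degree :: "'a set \<Rightarrow> 'a set set \<Rightarrow> nat" where
  "min_degree V E = Min (degree E ` V)"

definition regular_graph :: "'a set \<Rightarrow> 'a set set \<Rightarrow> bool" where
  "regular_graph V E \<longleftrightarrow> (\<exists>r. \<forall>u\<in>V. degree E u = r)"

text \<open>
  The term of an unordered pair \<open>e = {u, v}\<close> is written as the square root of a sum over the
  two elements of \<open>e\<close>, so that no choice of an order of the endpoints is involved; see
  \<open>sombor_term_pair\<close>.
\<close>

definition sombor_term :: "'a set set \<Rightarrow> 'a set \<Rightarrow> real" where
  "sombor_term E e = sqrt (\<Sum>u\<in>e. (real (degree E u))\<^sup>2)"

lemma sombor_term_pair:
  "u \<noteq> v \<Longrightarrow> sombor_term E {u, v} = sqrt ((real (degree E u))\<^sup>2 + (real (degree E v))\<^sup>2)"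
  by (simp add: sombor_term_def)

definition sombor_index :: "'a set set \<Rightarrow> real" where
  "sombor_index E = (\<Sum>e\<in>E. sombor_term E e)"

text \<open>The coindex sums over the edges of the complement, with degrees taken in the graph itself.\<close>

definition sombor_coindex :: "'a set \<Rightarrow> 'a set set \<Rightarrow> real" where
  "sombor_coindex V E = (\<Sum>e\<in>complement_edges V E. sombor_term E e)"

end

theory Submission
  imports Defs
begin

text \<open>
  Both inequalities hold term by term: if the two ends of a pair have degree at most \<open>D\<close>, the
  term of that pair is at most \<open>sqrt (D\<^sup>2 + D\<^sup>2) = sqrt 2 * D\<close>, with equality when both degrees
  are \<open>D\<close>. A Sombor sum over a set \<open>S\<close> of pairs is therefore at most \<open>card S * (sqrt 2 * D)\<close>
  (\<open>sombor_sum_le\<close>, \<open>sombor_sum_eq\<close>).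

  For the first part, the index and the coindex use the same degrees, so together they form one
  sum over all \<open>n (n - 1) / 2\<close> pairs of vertices, and \<open>D = \<Delta>\<close> gives the bound.

  For the second part, both sums range over the non-edges, but the index of the complement uses
  the complementary degrees. A vertex of degree \<open>d\<close> has degree \<open>n - 1 - d\<close> in the
  complement (\<open>degree_complement\<close>), so \<open>D = n - 1 - \<delta>\<close> serves for the first sum and
  \<open>D = \<Delta>\<close> for the second. In a regular graph all these degree bounds are equalities.
\<close>

lemma vertex_pairs_eq_card_2: "vertex_pairs V = {e. e \<subseteq> V \<and> card e = 2}"
  by (auto simp: vertex_pairs_def card_2_iff)

lemma finite_vertex_pairs: "finite V \<Longrightarrow> finite (vertex_pairs V)"
  by (rule finite_subset[of _ "Pow V"]) (auto simp: vertex_pairs_eq_card_2)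

lemma card_vertex_pairs:
  assumes "finite V"
  shows "real (card (vertex_pairs V)) = real (card V) * (real (card V) - 1) / 2"
proof -
  have "card (vertex_pairs V) = card V choose 2"
    using n_subsets[OF assms] by (simp add: vertex_pairs_eq_card_2)
  then show ?thesis
    by (cases "card V") (simp_all add: choose_two real_of_nat_div algebra_simps)
qed

lemma degree_vertex_pairs:
  assumes "u \<in> V"
  shows "degree (vertex_pairs V) u = card V - 1"
proof -
  have "{e \<in> vertex_pairs V. u \<in> e} = (\<lambda>v. {u, v}) ` (V - {u})"
    using assms by (auto simp: vertex_pairs_def)
  moreover have "inj_on (\<lambda>v. {u, v}) (V - {u})"
    by (auto simp: inj_on_def doubleton_eq_iff)
  ultimately show ?thesis
    using assms by (simp add: degree_def card_image)
qed

text \<open>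
  Each of the \<open>card V - 1\<close> pairs at \<open>u\<close> is an edge either of the graph or of its complement.
\<close>

lemma degree_complement:
  assumes "simple_graph V E" "u \<in> V"
  shows "real (degree (complement_edges V E) u) = real (card V) - 1 - real (degree E u)"
proof -
  have fin: "finite (vertex_pairs V)" and sub: "E \<subseteq> vertex_pairs V" and "finite V"
    using assms(1) by (auto simp: simple_graph_def finite_vertex_pairs)
  have "{e \<in> vertex_pairs V. u \<in> e} = {e \<in> E. u \<in> e} \<union> {e \<in> complement_edges V E. u \<in> e}"
    using sub by (auto simp: complement_edges_def)
  moreover have "card ({e \<in> E. u \<in> e} \<union> {e \<in> complement_edges V E. u \<in> e})
      = degree E u + degree (complement_edges V E) u"
    unfolding degree_def using fin sub
    by (intro card_Un_disjoint) (auto simp: complement_edges_def intro: finite_subset)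
  ultimately have "degree E u + degree (complement_edges V E) u = card V - 1"
    using degree_vertex_pairs[OF assms(2)] by (simp add: degree_def)
  moreover have "card V \<ge> 1"
    using \<open>finite V\<close> assms(2) by (auto simp: Suc_le_eq card_gt_0_iff)
  ultimately show ?thesis by linarith
qed

lemma sombor_term_le:
  assumes "e \<in> vertex_pairs V" "\<And>u. u \<in> V \<Longrightarrow> real (degree F u) \<le> D"
  shows "sombor_term F e \<le> sqrt 2 * D"
proof -
  obtain u v where e: "e = {u, v}" "u \<in> V" "v \<in> V" "u \<noteq> v"
    using assms(1) by (auto simp: vertex_pairs_def)
  have "0 \<le> D"
    using assms(2)[OF e(2)] by linarith
  have "(real (degree F u))\<^sup>2 + (real (degree F v))\<^sup>2 \<le> D\<^sup>2 + D\<^sup>2"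
    using assms(2) e by (intro add_mono power_mono) auto
  then have "sombor_term F e \<le> sqrt (2 * D\<^sup>2)"
    using e by (simp add: sombor_term_pair)
  then show ?thesis
    using \<open>0 \<le> D\<close> by (simp add: real_sqrt_mult)
qed

lemma sombor_term_eq:
  assumes "e \<in> vertex_pairs V" "\<And>u. u \<in> V \<Longrightarrow> real (degree F u) = D"
  shows "sombor_term F e = sqrt 2 * D"
proof -
  obtain u v where e: "e = {u, v}" "u \<in> V" "v \<in> V" "u \<noteq> v"
    using assms(1) by (auto simp: vertex_pairs_def)
  have "0 \<le> D"
    using assms(2)[OF e(2)] by linarith
  have "sombor_term F e = sqrt (2 * D\<^sup>2)"
    using assms(2) e by (simp add: sombor_term_pair)
  then show ?thesis
    using \<open>0 \<le> D\<close> by (simp add: real_sqrt_mult)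
qed

text \<open>
  The pairs summed over and the edges that define the degrees are independent, so that the
  bound applies to indices and coindices alike.
\<close>

lemma sombor_sum_le:
  assumes "S \<subseteq> vertex_pairs V" "\<And>u. u \<in> V \<Longrightarrow> real (degree F u) \<le> D"
  shows "(\<Sum>e\<in>S. sombor_term F e) \<le> real (card S) * (sqrt 2 * D)"
  using assms by (intro sum_bounded_above sombor_term_le) auto

lemma sombor_sum_eq:
  assumes "S \<subseteq> vertex_pairs V" "\<And>u. u \<in> V \<Longrightarrow> real (degree F u) = D"
  shows "(\<Sum>e\<in>S. sombor_term F e) = real (card S) * (sqrt 2 * D)"
proof -
  have "(\<Sum>e\<in>S. sombor_term F e) = (\<Sum>e\<in>S. sqrt 2 * D)"
    using assms by (intro sum.cong sombor_term_eq) auto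
  then show ?thesis by simp
qed

lemma sombor_index_plus_coindex:
  assumes "simple_graph V E"
  shows "sombor_index E + sombor_coindex V E = (\<Sum>e\<in>vertex_pairs V. sombor_term E e)"
proof -
  have "finite (vertex_pairs V)" "E \<subseteq> vertex_pairs V"
    using assms by (auto simp: simple_graph_def finite_vertex_pairs)
  then show ?thesis
    unfolding sombor_index_def sombor_coindex_def complement_edges_def
    by (simp add: sum.subset_diff)
qed

lemma regular_degree_extremal:
  assumes "simple_graph V E" "regular_graph V E" "u \<in> V"
  shows "degree E u = max_degree V E" "degree E u = min_degree V E"
proof -
  obtain r where r: "\<forall>v\<in>V. degree E v = r"
    using assms(2) by (auto simp: regular_graph_def)
  then have "degree E ` V = {r}"
    using assms(3) by auto
  then show "degree E u = max_degree V E" "degree E u = min_degree V E"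
    using r assms(3) by (simp_all add: max_degree_def min_degree_def)
qed

theorem theorem3p7:
  fixes V :: "'a set" and E :: "'a set set"
    and n m mbar \<Delta> \<delta> :: nat
  assumes "simple_graph V E"
    and "n = card V"
    and "m = card E"
    and "mbar = card (complement_edges V E)"
    and "\<Delta> = max_degree V E"
    and "\<delta> = min_degree V E"
  shows "(sombor_index E + sombor_coindex V E
            \<le> real n * (real n - 1) * real \<Delta> / sqrt 2
          \<and> (regular_graph V E \<longrightarrow>
              sombor_index E + sombor_coindex V E
              = real n * (real n - 1) * real \<Delta> / sqrt 2))
       \<and> (sombor_index (complement_edges V E) + sombor_coindex V E
            \<le> sqrt 2 * real mbar * (real n - 1 + real \<Delta> - real \<delta>)
          \<and> (regular_graph V E \<longrightarrow>
              sombor_index (complement_edges V E) + sombor_coindex V E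
              = sqrt 2 * real mbar * (real n - 1 + real \<Delta> - real \<delta>)))"
proof -
  let ?C = "complement_edges V E"
  have fin: "finite V"
    using assms(1) by (simp add: simple_graph_def)
  have sub: "?C \<subseteq> vertex_pairs V"
    by (auto simp: complement_edges_def)
  have le_max: "real (degree E u) \<le> real \<Delta>" if "u \<in> V" for u
    using that fin assms(5) by (simp add: max_degree_def)
  have "real \<delta> \<le> real (degree E u)" if "u \<in> V" for u
    using that fin assms(6) by (simp add: min_degree_def)
  then have compl_le: "real (degree ?C u) \<le> real n - 1 - real \<delta>" if "u \<in> V" for u
    using that degree_complement[OF assms(1)] assms(2) by fastforce
  have eq_max: "real (degree E u) = real \<Delta>" if "regular_graph V E" "u \<in> V" for u
    using regular_degree_extremal[OF assms(1) that] assms(5) by simp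
  have compl_eq: "real (degree ?C u) = real n - 1 - real \<delta>"
    if "regular_graph V E" "u \<in> V" for u
    using regular_degree_extremal[OF assms(1) that] degree_complement[OF assms(1) that(2)]
      assms(2,6) by simp

  have all_pairs: "real (card (vertex_pairs V)) * (sqrt 2 * real \<Delta>)
      = real n * (real n - 1) * real \<Delta> / sqrt 2"
    unfolding card_vertex_pairs[OF fin] assms(2) by (simp add: field_simps)
  have non_edges: "real (card ?C) * (sqrt 2 * (real n - 1 - real \<delta>))
        + real (card ?C) * (sqrt 2 * real \<Delta>)
      = sqrt 2 * real mbar * (real n - 1 + real \<Delta> - real \<delta>)"
    using assms(4) by (simp add: algebra_simps)

  show ?thesis
  proof (intro conjI impI)
    show "sombor_index E + sombor_coindex V E \<le> real n * (real n - 1) * real \<Delta> / sqrt 2"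
      using sombor_sum_le[of "vertex_pairs V", OF order_refl le_max]
      by (simp only: sombor_index_plus_coindex[OF assms(1)] all_pairs)
  next
    assume "regular_graph V E"
    then show "sombor_index E + sombor_coindex V E = real n * (real n - 1) * real \<Delta> / sqrt 2"
      using sombor_sum_eq[of "vertex_pairs V", OF order_refl eq_max]
      by (simp only: sombor_index_plus_coindex[OF assms(1)] all_pairs)
  next
    show "sombor_index ?C + sombor_coindex V E
        \<le> sqrt 2 * real mbar * (real n - 1 + real \<Delta> - real \<delta>)"
      using add_mono[OF sombor_sum_le[OF sub compl_le] sombor_sum_le[OF sub le_max]]
      by (simp only: sombor_index_def sombor_coindex_def non_edges)
  next
    assume "regular_graph V E"
    then show "sombor_index ?C + sombor_coindex V E
        = sqrt 2 * real mbar * (real n - 1 + real \<Delta> - real \<delta>)"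
      using sombor_sum_eq[OF sub compl_eq] sombor_sum_eq[OF sub eq_max]
      by (simp only: sombor_index_def sombor_coindex_def non_edges)
  qed
qed

end
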